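(* Let $k$ be an integer and $G$ be a multigraph. Then there is a cut $(A,B)$ in $G$ of order at most $2k$ such that $G[A]$ is $k$-edge-connected or has only one vertex.
   Context: Multigraphs may have multiple edges and loops. A cut in a multigraph $G$ is a partition $(A,B)$ of $V(G)$ into two parts; $E(A,B)$ denotes the set of edges of $G$ incident with a vertex in both $A$ and $B$, and $|E(A,B)|$ is the order of the cut. $G[A]$ denotes the subgraph of $G$ induced on $A$. The term $k$-edge-connected has its usual meaning: the multigraph remains connected after the removal of any fewer than $k$ edges.
   Formalization: The multigraph is taken to be finite and nonempty and k to be a nonnegative integer (the claim fails for negative k and for the infinite 10-regular tree with k = 2); the part B of the cut may be empty. *)

theory Defs
  imports Main "HOL-Library.Uprod"
begin

text \<open>
  Edges have their own identities, so several edges may have the same pair of ends;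
  a loop at \<open>v\<close> is an edge with ends \<open>Upair v v\<close>.
\<close>

record ('v, 'e) multigraph =
  verts :: "'v set"
  edges :: "'e set"
  ends :: "'e \<Rightarrow> 'v uprod"

locale finite_multigraph =
  fixes G :: "('v, 'e) multigraph"
  assumes finite_verts: "finite (verts G)"
    and finite_edges: "finite (edges G)"
    and verts_nonempty: "verts G \<noteq> {}"
    and ends_in_verts: "e \<in> edges G \<Longrightarrow> set_uprod (ends G e) \<subseteq> verts G"

definition adj :: "('v, 'e) multigraph \<Rightarrow> ('v \<times> 'v) set" where
  "adj G = {(u, v). \<exists>e \<in> edges G. ends G e = Upair u v}"

definition connected_multigraph :: "('v, 'e) multigraph \<Rightarrow> bool" where
  "connected_multigraph G \<longleftrightarrow>
     verts G \<noteq> {} \<and> (\<forall>u \<in> verts G. \<forall>v \<in> verts G. (u, v) \<in> (adj G)\<^sup>*)"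

definition delete_edges :: "('v, 'e) multigraph \<Rightarrow> 'e set \<Rightarrow> ('v, 'e) multigraph" where
  "delete_edges G F = G\<lparr>edges := edges G - F\<rparr>"

text \<open>
  Nonemptiness is required separately because for \<open>k = 0\<close> the condition on removed edges
  is vacuous and would otherwise hold for the graph without vertices.
\<close>

definition k_edge_connected :: "nat \<Rightarrow> ('v, 'e) multigraph \<Rightarrow> bool" where
  "k_edge_connected k G \<longleftrightarrow>
     verts G \<noteq> {} \<and>
     (\<forall>F \<subseteq> edges G. finite F \<and> card F < k \<longrightarrow> connected_multigraph (delete_edges G F))"

definition induced_subgraph :: "('v, 'e) multigraph \<Rightarrow> 'v set \<Rightarrow> ('v, 'e) multigraph" where
  "induced_subgraph G A =
     G\<lparr>verts := A, edges := {e \<in> edges G. set_uprod (ends G e) \<subseteq> A}\<rparr>"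

text \<open>
  A part of a cut may be empty: a highly edge-connected graph only has cuts of small order
  of the form \<open>(V(G), {})\<close> or \<open>({}, V(G))\<close>.
\<close>

definition is_cut :: "('v, 'e) multigraph \<Rightarrow> 'v set \<Rightarrow> 'v set \<Rightarrow> bool" where
  "is_cut G A B \<longleftrightarrow> A \<union> B = verts G \<and> A \<inter> B = {}"

definition cut_edges :: "('v, 'e) multigraph \<Rightarrow> 'v set \<Rightarrow> 'v set \<Rightarrow> 'e set" where
  "cut_edges G A B =
     {e \<in> edges G. set_uprod (ends G e) \<inter> A \<noteq> {} \<and> set_uprod (ends G e) \<inter> B \<noteq> {}}"

definition cut_order :: "('v, 'e) multigraph \<Rightarrow> 'v set \<Rightarrow> 'v set \<Rightarrow> nat" where
  "cut_order G A B = card (cut_edges G A B)"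

end

theory Submission
  imports Defs
begin

text \<open>
  Among the nonempty vertex sets whose boundary has at most \<open>2 * k\<close> edges take a smallest one, \<open>A\<close>.
  If fewer than \<open>k\<close> edges separated \<open>G[A]\<close> into nonempty parts \<open>C\<close> and \<open>D\<close>, then
  the boundaries of \<open>C\<close> and \<open>D\<close> together would have at most \<open>2 * k + 2 * (k - 1)\<close> edges, since
  each edge leaving \<open>A\<close> is counted once and each edge between \<open>C\<close> and \<open>D\<close> twice. So \<open>C\<close> or \<open>D\<close>
  would contradict the choice of \<open>A\<close>.
\<close>

lemma cut_edges_commute: "cut_edges G A B = cut_edges G B A"
  by (auto simp: cut_edges_def)

lemma cut_edges_Un_right: "cut_edges G A (B \<union> C) = cut_edges G A B \<union> cut_edges G A C"
  by (auto simp: cut_edges_def)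

lemma finite_cut_edges: "finite (edges G) \<Longrightarrow> finite (cut_edges G A B)"
  by (simp add: cut_edges_def)

text \<open>Disjointness makes the end in \<open>A\<close> and the end in \<open>B\<close> two
  different vertices, so they are all the ends of \<open>e\<close>; the unordered pair can then be
  written with the end in \<open>A\<close> first.\<close>

lemma cut_edgesE:
  assumes "e \<in> cut_edges G A B" "A \<inter> B = {}"
  obtains a b where "e \<in> edges G" "ends G e = Upair a b" "a \<in> A" "b \<in> B"
proof -
  obtain a b where ab: "ends G e = Upair a b"
    by (cases "ends G e") auto
  have "a \<in> A \<and> b \<in> B \<or> b \<in> A \<and> a \<in> B"
    using assms ab by (auto simp: cut_edges_def)
  moreover have "Upair a b = Upair b a"
    by simp
  ultimately show thesis
    using assms(1) ab that by (auto simp: cut_edges_def)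
qed

text \<open>An edge has at most two ends, so it cannot meet three pairwise disjoint sets.\<close>

lemma cut_edges_Int_eq_empty:
  assumes "A \<inter> B = {}" "A \<inter> C = {}" "B \<inter> C = {}"
  shows "cut_edges G A C \<inter> cut_edges G B C = {}"
proof -
  have False if e: "e \<in> cut_edges G A C" "e \<in> cut_edges G B C" for e
  proof -
    obtain a c where "ends G e = Upair a c" "a \<in> A" "c \<in> C"
      using cut_edgesE[OF e(1) assms(2)] by metis
    with e(2) assms show False
      by (auto simp: cut_edges_def)
  qed
  then show ?thesis
    by blast
qed

lemma cut_order_Un_le:
  assumes "finite (edges G)" "C \<inter> D = {}" "C \<inter> B = {}" "D \<inter> B = {}"
  shows "cut_order G C (D \<union> B) + cut_order G D (C \<union> B)
    \<le> cut_order G (C \<union> D) B + 2 * cut_order G C D"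
proof -
  have "cut_order G C (D \<union> B) \<le> cut_order G C D + cut_order G C B"
    unfolding cut_order_def cut_edges_Un_right by (rule card_Un_le)
  moreover have "cut_order G D (C \<union> B) \<le> cut_order G C D + cut_order G D B"
    unfolding cut_order_def cut_edges_Un_right
    by (metis card_Un_le cut_edges_commute)
  \<comment> \<open>Here the union bound would point the wrong way: equality holds because no edge
    to \<open>B\<close> has ends in both \<open>C\<close> and \<open>D\<close>.\<close>
  moreover have "cut_order G (C \<union> D) B = cut_order G C B + cut_order G D B"
    unfolding cut_order_def cut_edges_commute[of G _ B] cut_edges_Un_right
    using cut_edges_Int_eq_empty[OF assms(2-4)] assms(1)
    by (intro card_Un_disjoint) (simp_all add: finite_cut_edges cut_edges_commute[of G B])
  ultimately show ?thesis
    by simp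
qed

lemma not_k_edge_connected_imp_small_cut:
  assumes "\<not> k_edge_connected k (induced_subgraph G A)" "A \<noteq> {}"
  obtains C D where "C \<noteq> {}" "D \<noteq> {}" "C \<inter> D = {}" "C \<union> D = A" "cut_order G C D < k"
proof -
  obtain F where F: "finite F" "card F < k"
      and "\<not> connected_multigraph (delete_edges (induced_subgraph G A) F)"
    using assms by (auto simp: k_edge_connected_def induced_subgraph_def)
  moreover define R where "R = adj (delete_edges (induced_subgraph G A) F)"
  ultimately obtain u v where uv: "u \<in> A" "v \<in> A" "(u, v) \<notin> R\<^sup>*"
    using assms(2)
    by (auto simp: connected_multigraph_def delete_edges_def induced_subgraph_def)
  \<comment> \<open>The part of \<open>u\<close> after deleting \<open>F\<close>: it contains
    \<open>u\<close> but not \<open>v\<close>, so both sides of the cut are nonempty.\<close>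
  define C where "C = {w \<in> A. (u, w) \<in> R\<^sup>*}"
  \<comment> \<open>An edge of this cut outside \<open>F\<close> would survive the deletion and make
    its end in \<open>A - C\<close> reachable from \<open>u\<close>.\<close>
  have "cut_edges G C (A - C) \<subseteq> F"
  proof
    fix e assume "e \<in> cut_edges G C (A - C)"
    then obtain a b where e: "e \<in> edges G" "ends G e = Upair a b" "a \<in> C" "b \<in> A - C"
      by (rule cut_edgesE) auto
    show "e \<in> F"
    proof (rule ccontr)
      assume "e \<notin> F"
      with e have "(a, b) \<in> R"
        by (auto simp: R_def adj_def delete_edges_def induced_subgraph_def C_def)
      with e show False
        by (auto simp: C_def dest: rtrancl_into_rtrancl)
    qed
  qed
  with F have "cut_order G C (A - C) < k"
    unfolding cut_order_def by (meson card_mono le_less_trans)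
  with uv show thesis
    by (intro that[of C "A - C"]) (auto simp: C_def)
qed

theorem lemma7:
  fixes k :: nat and G :: "('v, 'e) multigraph"
  assumes "finite_multigraph G"
  shows "\<exists>A B. is_cut G A B \<and> cut_order G A B \<le> 2 * k \<and>
           (k_edge_connected k (induced_subgraph G A) \<or>
            card (verts (induced_subgraph G A)) = 1)"
proof -
  interpret finite_multigraph G by fact
  define P where "P X \<longleftrightarrow> X \<subseteq> verts G \<and> X \<noteq> {} \<and> cut_order G X (verts G - X) \<le> 2 * k" for X
  \<comment> \<open>No edge meets the empty part, so this cut has order 0 and a smallest set
    exists.\<close>
  have "P (verts G)"
    using verts_nonempty by (simp add: P_def cut_order_def cut_edges_def)
  then obtain A where A: "P A" and min: "\<And>X. P X \<Longrightarrow> card A \<le> card X"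
    using ex_has_least_nat[of P "verts G" card] by blast
  let ?B = "verts G - A"
  \<comment> \<open>This includes a single vertex, which cannot be split into two nonempty
    parts.\<close>
  have "k_edge_connected k (induced_subgraph G A)"
  proof (rule ccontr)
    assume "\<not> k_edge_connected k (induced_subgraph G A)"
    then obtain C D where CD: "C \<noteq> {}" "D \<noteq> {}" "C \<inter> D = {}" "C \<union> D = A"
        and small: "cut_order G C D < k"
      using A not_k_edge_connected_imp_small_cut unfolding P_def by metis
    have sub: "A \<subseteq> verts G"
      using A by (simp add: P_def)
    have "verts G - C = D \<union> ?B" "verts G - D = C \<union> ?B"
      using CD sub by blast+
    then have "cut_order G C (verts G - C) + cut_order G D (verts G - D)
        \<le> cut_order G A ?B + 2 * cut_order G C D"
      using cut_order_Un_le[OF finite_edges, of C D ?B] CD by auto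
    also have "\<dots> < 4 * k"
      using A small by (simp add: P_def)
    \<comment> \<open>Two boundaries with sum below \<open>4 * k\<close> cannot both exceed
      \<open>2 * k\<close>.\<close>
    finally have "P C \<or> P D"
      using CD sub by (auto simp: P_def)
    moreover have "C \<subset> A" "D \<subset> A"
      using CD by blast+
    then have "card C < card A" "card D < card A"
      using finite_subset[OF sub finite_verts] by (simp_all add: psubset_card_mono)
    ultimately show False
      using min by (meson leD)
  qed
  moreover have "is_cut G A ?B" "cut_order G A ?B \<le> 2 * k"
    using A by (auto simp: P_def is_cut_def)
  ultimately show ?thesis
    by blast
qed

end
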